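(* Let $D$ be a positive integer whose square root is irrational, and let $\beta=\sqrt{D}$. Then $\beta$ satisfies property (CFP). Moreover, if Mercat's Conjecture holds, then $\beta$ does not satisfy property (CFF).
   Context: Mercat's Conjecture: every real quadratic field contains an element whose regular (classical, simple) continued fraction expansion is periodic with all partial quotients equal to 1 or 2. $\beta$-integers: for real $\beta>1$, every real $x\ge 0$ has a unique (up to leading zeros) greedy $\beta$-expansion $x=\sum_{i=-\infty}^{k}x_i\beta^i$ with integer digits $0\le x_i<\beta$ such that $\sum_{i=-\infty}^{j}x_i\beta^i<\beta^{j+1}$ for every $j\le k$. The set $\mathbb{Z}_\beta$ of $\beta$-integers consists of all real $x$ such that the greedy $\beta$-expansion of $|x|$ has $x_i=0$ for all $i<0$. $\beta$-continued fraction of $\xi\in\mathbb{R}$: put $\xi_0=\xi$ and, for $n\ge 0$, $a_n=\max\{y\in\mathbb{Z}_\beta: y\le \xi_n\}$; if $\xi_n\in\mathbb{Z}_\beta$ the algorithm stops and the expansion $[a_0,\dots,a_n]$ is finite; otherwise $\xi_{n+1}=1/(\xi_n-a_n)$. If it never stops, the expansion is the infinite sequence $[a_0,a_1,\dotsc]$. Property (CFF): every element of $\mathbb{Q}(\beta)$ has a finite $\beta$-continued fraction expansion. Property (CFP): every element of $\mathbb{Q}(\beta)$ has a finite or eventually periodic $\beta$-continued fraction expansion. *)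

theory Defs
  imports "HOL-Analysis.Analysis"
begin

text \<open>Subfields of the reals, the field $\mathbb{Q}(\beta)$ and real quadratic fields.\<close>

definition real_subfield :: "real set \<Rightarrow> bool" where
  "real_subfield K \<longleftrightarrow> 0 \<in> K \<and> 1 \<in> K \<and>
     (\<forall>x\<in>K. \<forall>y\<in>K. x + y \<in> K \<and> x * y \<in> K) \<and>
     (\<forall>x\<in>K. - x \<in> K \<and> inverse x \<in> K)"

definition rat_adjoin :: "real \<Rightarrow> real set" where
  "rat_adjoin \<beta> = \<Inter>{K. real_subfield K \<and> \<beta> \<in> K}"

abbreviation rat_scale :: "rat \<Rightarrow> real \<Rightarrow> real" where
  "rat_scale q x \<equiv> of_rat q * x"

lemma vector_space_rat_scale: "vector_space rat_scale"
  by unfold_locales (simp_all add: algebra_simps of_rat_add of_rat_mult)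

definition real_quadratic_field :: "real set \<Rightarrow> bool" where
  "real_quadratic_field K \<longleftrightarrow> real_subfield K \<and> vector_space.dim rat_scale K = 2"

text \<open>
  The digit sequence is indexed by all integers and vanishes above some index \<open>k\<close>;
  expansions that differ only by leading zeros are thereby the same function.
\<close>

definition greedy_expansion :: "real \<Rightarrow> (int \<Rightarrow> nat) \<Rightarrow> real \<Rightarrow> bool" where
  "greedy_expansion \<beta> d x \<longleftrightarrow>
     (\<exists>k. (\<forall>i>k. d i = 0) \<and>
          (\<forall>i\<le>k. real (d i) < \<beta>) \<and>
          ((\<lambda>i. real (d i) * \<beta> powi i) has_sum x) {..k} \<and>
          (\<forall>j\<le>k. (\<Sum>\<^sub>\<infinity>i\<in>{..j}. real (d i) * \<beta> powi i) < \<beta> powi (j + 1)))"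

definition beta_integers :: "real \<Rightarrow> real set" where
  "beta_integers \<beta> = {x. \<exists>d. greedy_expansion \<beta> d \<bar>x\<bar> \<and> (\<forall>i<0. d i = 0)}"

text \<open>
  Continued fraction algorithm with partial quotients in a set \<open>S\<close>. For
  \<open>S = beta_integers \<beta>\<close> it yields the $\beta$-continued fraction, for \<open>S = \<int>\<close> the
  regular one. The value \<open>None\<close> means that the algorithm has stopped before step \<open>n\<close>.
\<close>

definition floor_in :: "real set \<Rightarrow> real \<Rightarrow> real" where
  "floor_in S x = (GREATEST y. y \<in> S \<and> y \<le> x)"

lemma floor_in_Ints: "floor_in \<int> x = of_int \<lfloor>x\<rfloor>"
  unfolding floor_in_def
proof (rule Greatest_equality)
  fix y :: real assume "y \<in> \<int> \<and> y \<le> x"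
  then show "y \<le> of_int \<lfloor>x\<rfloor>" by (auto elim!: Ints_cases simp: le_floor_iff)
qed simp

primrec cf_complete_quotient :: "real set \<Rightarrow> real \<Rightarrow> nat \<Rightarrow> real option" where
  "cf_complete_quotient S \<xi> 0 = Some \<xi>"
| "cf_complete_quotient S \<xi> (Suc n) =
     (case cf_complete_quotient S \<xi> n of
        None \<Rightarrow> None
      | Some x \<Rightarrow> if x \<in> S then None else Some (1 / (x - floor_in S x)))"

definition cf_partial_quotient :: "real set \<Rightarrow> real \<Rightarrow> nat \<Rightarrow> real option" where
  "cf_partial_quotient S \<xi> n = map_option (floor_in S) (cf_complete_quotient S \<xi> n)"

definition cf_finite :: "real set \<Rightarrow> real \<Rightarrow> bool" where
  "cf_finite S \<xi> \<longleftrightarrow> (\<exists>n. cf_partial_quotient S \<xi> n = None)"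

definition cf_eventually_periodic :: "real set \<Rightarrow> real \<Rightarrow> bool" where
  "cf_eventually_periodic S \<xi> \<longleftrightarrow> \<not> cf_finite S \<xi> \<and>
     (\<exists>N. \<exists>p>0. \<forall>n\<ge>N. cf_partial_quotient S \<xi> (n + p) = cf_partial_quotient S \<xi> n)"

definition cf_periodic :: "real set \<Rightarrow> real \<Rightarrow> bool" where
  "cf_periodic S \<xi> \<longleftrightarrow> \<not> cf_finite S \<xi> \<and>
     (\<exists>p>0. \<forall>n. cf_partial_quotient S \<xi> (n + p) = cf_partial_quotient S \<xi> n)"

definition CFF :: "real \<Rightarrow> bool" where
  "CFF \<beta> \<longleftrightarrow> (\<forall>\<xi>\<in>rat_adjoin \<beta>. cf_finite (beta_integers \<beta>) \<xi>)"

definition CFP :: "real \<Rightarrow> bool" where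
  "CFP \<beta> \<longleftrightarrow> (\<forall>\<xi>\<in>rat_adjoin \<beta>.
     cf_finite (beta_integers \<beta>) \<xi> \<or> cf_eventually_periodic (beta_integers \<beta>) \<xi>)"

definition Mercat_conjecture :: bool where
  "Mercat_conjecture \<longleftrightarrow> (\<forall>K. real_quadratic_field K \<longrightarrow>
     (\<exists>\<xi>\<in>K. cf_periodic \<int> \<xi> \<and> (\<forall>n. cf_partial_quotient \<int> \<xi> n \<in> {Some 1, Some 2})))"

end

theory Submission
  imports Defs
begin

text \<open>
  Let \<open>\<beta> = sqrt D\<close>. Even powers of \<open>\<beta>\<close> are natural numbers and odd powers are natural multiples
  of \<open>\<beta>\<close>, so every nonnegative \<open>\<beta>\<close>-integer has the form \<open>a = u + v * \<beta>\<close> with natural numbers \<open>u\<close>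
  and \<open>v\<close>. Consequently its conjugate \<open>u - v * \<beta>\<close> is at most \<open>a\<close> in absolute value.

  Periodicity rests on this inequality. Write the complete quotients as ratios
  \<open>g_n / g_(n+1)\<close>, where \<open>g_(n+2) = g_n - a_n * g_(n+1)\<close> and all \<open>g_n\<close> have integer coefficients
  with respect to \<open>1\<close> and \<open>\<beta>\<close>, and let \<open>q_(n+2) = q_n + a_n * q_(n+1)\<close> be the associated
  denominators. The quantity \<open>g_n * q_(n+1) + g_(n+1) * q_n\<close> is constant, so \<open>g_n\<close> is of order at
  most \<open>1 / q_(n+1)\<close>, whereas the conjugate of \<open>g_n\<close> is of order at most \<open>q_n\<close>. Multiplying
  numerator and denominator of \<open>g_n / g_(n+1)\<close> by the conjugate of \<open>g_(n+1)\<close> yields a bounded integer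
  as denominator and, as numerator, a quadratic integer that is bounded together with its
  conjugate. Only finitely many complete quotients are possible (\<open>finite_cf_invariant\<close>), and since
  each one determines the next, the expansion is finite or eventually periodic.

  For the failure of finiteness, suppose first that \<open>D \<ge> 9\<close>. A number in the field whose regular
  partial quotients are all \<open>1\<close> or \<open>2\<close> has complete quotients below \<open>3 \<le> \<beta>\<close>. In this range the
  \<open>\<beta>\<close>-integers are the ordinary integers, so the regular expansion is also the
  \<open>\<beta>\<close>-expansion, and it is infinite (\<open>not_cf_finite_of_partial_quotients_1_2\<close>). For the remaining
  \<open>D\<close> in \<open>{2, 3, 5, 6, 7, 8}\<close> an explicit purely periodic \<open>\<beta>\<close>-continued fraction is given. In all
  cases floors are computed digit by digit with \<open>is_floor_add_digit\<close>.
\<close>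

section \<open>The \<open>\<beta>\<close>-integers below a power of \<open>\<beta>\<close>\<close>

text \<open>
  A recursive description, by leading digit, of the nonnegative \<open>\<beta>\<close>-integers below
  \<open>\<beta> ^ m\<close>. The bound \<open>x < \<beta> ^ Suc m\<close> imposed at every stage is exactly the greedy
  condition on the partial sum of the digits with index at most \<open>m\<close>; the agreement with
  the digit-sequence definition is \<open>greedy_below_eq\<close> below.
\<close>

primrec greedy_below :: "real \<Rightarrow> nat \<Rightarrow> real set" where
  "greedy_below \<beta> 0 = {0}"
| "greedy_below \<beta> (Suc m) =
     {x. x < \<beta> ^ Suc m \<and> (\<exists>d::nat. \<exists>y\<in>greedy_below \<beta> m. real d < \<beta> \<and> x = real d * \<beta> ^ m + y)}"

declare greedy_below.simps(2) [simp del]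

lemma greedy_below_SucI:
  "y \<in> greedy_below \<beta> m \<Longrightarrow> real d < \<beta> \<Longrightarrow> real d * \<beta> ^ m + y < \<beta> ^ Suc m \<Longrightarrow>
     real d * \<beta> ^ m + y \<in> greedy_below \<beta> (Suc m)"
  by (auto simp: greedy_below.simps(2))

lemma greedy_below_SucE:
  assumes "x \<in> greedy_below \<beta> (Suc m)"
  obtains d y where "x < \<beta> ^ Suc m" "real d < \<beta>" "x = real d * \<beta> ^ m + y" "y \<in> greedy_below \<beta> m"
  using assms by (auto simp: greedy_below.simps(2))

lemma greedy_below_bounds:
  assumes "\<beta> > 1" "x \<in> greedy_below \<beta> m"
  shows "0 \<le> x" "x < \<beta> ^ m"
  using assms(2)
proof (induction m arbitrary: x)
  case (Suc m)
  { case 1 with Suc \<open>\<beta> > 1\<close> show ?case by (auto elim!: greedy_below_SucE) }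
  { case 2 then show ?case by (auto elim: greedy_below_SucE) }
qed (use assms in auto)

text \<open>
  Without fractional digits the expansion, formally a sum over all integers below a bound,
  collapses to a finite sum over natural exponents. For \<open>m = 0\<close> the range contains only
  negative indices and both sides vanish.
\<close>

lemma has_sum_nonneg_digits:
  fixes d :: "int \<Rightarrow> nat" and \<beta> :: real
  assumes "\<forall>i<0. d i = 0"
  shows "((\<lambda>i. real (d i) * \<beta> powi i) has_sum (\<Sum>i<m. real (d (int i)) * \<beta> ^ i)) {..int m - 1}"
proof -
  have "((\<lambda>i. real (d i) * \<beta> powi i) has_sum (\<Sum>i\<in>int ` {..<m}. real (d i) * \<beta> powi i)) (int ` {..<m})"
    by (rule has_sum_finite) simp
  also have "(\<Sum>i\<in>int ` {..<m}. real (d i) * \<beta> powi i) = (\<Sum>i<m. real (d (int i)) * \<beta> ^ i)"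
    by (subst sum.reindex) (auto simp: o_def)
  finally show ?thesis
  proof (rule has_sum_cong_neutral[THEN iffD1, rotated -1])
    fix i assume "i \<in> {..int m - 1} - int ` {..<m}"
    then have "i < 0"
      by (cases "i \<ge> 0") (auto simp: image_iff dest: bspec[where x = "nat i"])
    then show "real (d i) * \<beta> powi i = 0" using assms by simp
  qed auto
qed

text \<open>
  Adding the digits from the lowest one upwards, every partial sum stays in the recursive
  description, because the greedy inequality at \<open>j\<close> is the bound required at stage \<open>j + 1\<close>.
\<close>

lemma beta_integer_imp_greedy_below:
  assumes "\<beta> > 1" "x \<in> beta_integers \<beta>" "x \<ge> 0"
  shows "\<exists>m. x \<in> greedy_below \<beta> m"
proof -
  obtain d k where d0: "\<forall>i<0. d i = 0" and dk: "\<forall>i>k. d i = 0"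
    and digit: "\<forall>i\<le>k. real (d i) < \<beta>"
    and sum: "((\<lambda>i. real (d i) * \<beta> powi i) has_sum x) {..k}"
    and greedy: "\<forall>j\<le>k. (\<Sum>\<^sub>\<infinity>i\<in>{..j}. real (d i) * \<beta> powi i) < \<beta> powi (j + 1)"
    using assms(2,3) unfolding beta_integers_def greedy_expansion_def by auto
  let ?s = "\<lambda>m. \<Sum>i<m. real (d (int i)) * \<beta> ^ i"
  have digit': "real (d i) < \<beta>" for i
    using digit dk \<open>\<beta> > 1\<close> by (cases "i \<le> k") auto
  have partial: "?s m \<in> greedy_below \<beta> m" if "int m \<le> k + 1" for m
    using that
  proof (induction m)
    case (Suc m)
    have "?s (Suc m) < \<beta> powi (int m + 1)"
      using greedy[rule_format, of "int m"] has_sum_nonneg_digits[OF d0, of \<beta> "Suc m"] Suc.prems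
      by (simp add: infsumI)
    also have "\<beta> powi (int m + 1) = \<beta> ^ Suc m"
      by (metis of_nat_Suc power_int_of_nat add.commute)
    finally have lt: "?s (Suc m) < \<beta> ^ Suc m" .
    moreover have "?s m \<in> greedy_below \<beta> m" using Suc by simp
    ultimately show ?case
      using digit'[of "int m"] greedy_below_SucI[of "?s m" \<beta> m "d (int m)"]
      by (simp add: add.commute)
  qed simp
  show ?thesis
  proof (cases "k \<ge> 0")
    case True
    then have k: "k = int (nat (k + 1)) - 1" by simp
    have "x = ?s (nat (k + 1))"
      using has_sum_nonneg_digits[OF d0, of \<beta> "nat (k + 1)"] sum k has_sum_unique by metis
    then show ?thesis using partial[of "nat (k + 1)"] True by auto
  next
    case False
    then have "((\<lambda>i. real (d i) * \<beta> powi i) has_sum 0) {..k}"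
      using d0 by (intro has_sum_0) auto
    then have "x = 0" using sum has_sum_unique by blast
    then show ?thesis by (auto intro: exI[of _ 0])
  qed
qed

lemma greedy_below_imp_digits:
  assumes "\<beta> > 1" "x \<in> greedy_below \<beta> m"
  shows "\<exists>d::int \<Rightarrow> nat. (\<forall>i<0. d i = 0) \<and> (\<forall>i\<ge>int m. d i = 0) \<and> (\<forall>i. real (d i) < \<beta>) \<and>
           x = (\<Sum>i<m. real (d (int i)) * \<beta> ^ i) \<and>
           (\<forall>j\<le>m. (\<Sum>i<j. real (d (int i)) * \<beta> ^ i) < \<beta> ^ j)"
  using assms(2)
proof (induction m arbitrary: x)
  case 0
  then show ?case using assms(1) by (intro exI[of _ "\<lambda>_. 0"]) auto
next
  case (Suc m)
  then obtain e y where x: "x < \<beta> ^ Suc m" "real e < \<beta>" "x = real e * \<beta> ^ m + y"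
    and "y \<in> greedy_below \<beta> m"
    by (elim greedy_below_SucE)
  then obtain d where d: "\<forall>i<0. d i = 0" "\<forall>i\<ge>int m. d i = 0" "\<forall>i. real (d i) < \<beta>"
      "y = (\<Sum>i<m. real (d (int i)) * \<beta> ^ i)"
      "\<forall>j\<le>m. (\<Sum>i<j. real (d (int i)) * \<beta> ^ i) < \<beta> ^ j"
    using Suc.IH by blast
  let ?d = "d(int m := e)"
  have low: "(\<Sum>i<j. real (?d (int i)) * \<beta> ^ i) = (\<Sum>i<j. real (d (int i)) * \<beta> ^ i)"
    if "j \<le> m" for j
    using that by (intro sum.cong) auto
  have top: "(\<Sum>i<Suc m. real (?d (int i)) * \<beta> ^ i) = x"
    using low[of m] d(4) x(3) by simp
  have "(\<Sum>i<j. real (?d (int i)) * \<beta> ^ i) < \<beta> ^ j" if "j \<le> Suc m" for j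
    using low[of j] top x(1) d(5) that by (cases "j = Suc m") auto
  then show ?case
    using d x top by (intro exI[of _ ?d]) auto
qed

lemma greedy_below_imp_beta_integer:
  assumes "\<beta> > 1" "x \<in> greedy_below \<beta> m"
  shows "x \<in> beta_integers \<beta>"
proof -
  obtain d :: "int \<Rightarrow> nat" where d: "\<forall>i<0. d i = 0" "\<forall>i\<ge>int m. d i = 0" "\<forall>i. real (d i) < \<beta>"
      "x = (\<Sum>i<m. real (d (int i)) * \<beta> ^ i)"
      "\<forall>j\<le>m. (\<Sum>i<j. real (d (int i)) * \<beta> ^ i) < \<beta> ^ j"
    using greedy_below_imp_digits[OF assms] by blast
  have "(\<Sum>\<^sub>\<infinity>i\<in>{..j}. real (d i) * \<beta> powi i) < \<beta> powi (j + 1)" if "j \<le> int m - 1" for j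
  proof (cases "j \<ge> 0")
    case True
    define n where "n = nat (j + 1)"
    have n: "j = int n - 1" "n \<le> m" using True that by (auto simp: n_def)
    have "(\<Sum>\<^sub>\<infinity>i\<in>{..j}. real (d i) * \<beta> powi i) = (\<Sum>i<n. real (d (int i)) * \<beta> ^ i)"
      using has_sum_nonneg_digits[OF d(1), of \<beta> n] n by (simp add: infsumI)
    also have "\<dots> < \<beta> ^ n" using d(5) n by simp
    also have "\<beta> ^ n = \<beta> powi (j + 1)" using n by simp
    finally show ?thesis .
  next
    case False
    then have "(\<Sum>\<^sub>\<infinity>i\<in>{..j}. real (d i) * \<beta> powi i) = 0"
      using d(1) by (intro infsum_0) auto
    then show ?thesis using \<open>\<beta> > 1\<close> by simp
  qed
  moreover have "x \<ge> 0" using greedy_below_bounds[OF assms] by simp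
  ultimately have "greedy_expansion \<beta> d \<bar>x\<bar>"
    unfolding greedy_expansion_def
    using d has_sum_nonneg_digits[OF d(1), of \<beta> m]
    by (intro exI[of _ "int m - 1"]) auto
  then show ?thesis using d(1) unfolding beta_integers_def by blast
qed

text \<open>
  A number below \<open>\<beta> ^ m\<close> has leading digit \<open>0\<close> in position \<open>m\<close>. Hence an upper bound on a
  \<open>\<beta>\<close>-integer bounds the length of its expansion.
\<close>

lemma greedy_below_Suc_iff:
  assumes "\<beta> > 1" "x < \<beta> ^ m"
  shows "x \<in> greedy_below \<beta> (Suc m) \<longleftrightarrow> x \<in> greedy_below \<beta> m"
proof
  assume "x \<in> greedy_below \<beta> (Suc m)"
  then obtain d :: nat and y where d: "real d < \<beta>" "x = real d * \<beta> ^ m + y"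
    and y: "y \<in> greedy_below \<beta> m"
    by (elim greedy_below_SucE)
  have "d = 0"
  proof (rule ccontr)
    assume "d \<noteq> 0"
    then have "1 * \<beta> ^ m \<le> real d * \<beta> ^ m" using assms(1) by (intro mult_right_mono) auto
    then show False using d greedy_below_bounds[OF assms(1) y] assms(2) by linarith
  qed
  then show "x \<in> greedy_below \<beta> m" using d y by simp
next
  assume x: "x \<in> greedy_below \<beta> m"
  have "\<beta> ^ m < \<beta> ^ Suc m" using assms(1) by (intro power_strict_increasing) auto
  then have "x < \<beta> ^ Suc m" using assms(2) by linarith
  then show "x \<in> greedy_below \<beta> (Suc m)"
    using greedy_below_SucI[OF x, of 0] assms(1) by simp
qed

lemma greedy_below_add_iff:
  assumes "\<beta> > 1" "x < \<beta> ^ m"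
  shows "x \<in> greedy_below \<beta> (m + n) \<longleftrightarrow> x \<in> greedy_below \<beta> m"
proof (induction n)
  case (Suc n)
  have "\<beta> ^ m \<le> \<beta> ^ (m + n)" using assms(1) by (intro power_increasing) auto
  then have "x < \<beta> ^ (m + n)" using assms(2) by linarith
  from greedy_below_Suc_iff[OF assms(1) this] Suc show ?case by simp
qed simp

lemma greedy_below_eq:
  assumes "\<beta> > 1"
  shows "greedy_below \<beta> m = {x \<in> beta_integers \<beta>. 0 \<le> x \<and> x < \<beta> ^ m}"
proof (intro equalityI subsetI CollectI conjI)
  fix x assume "x \<in> {x \<in> beta_integers \<beta>. 0 \<le> x \<and> x < \<beta> ^ m}"
  then have x: "x \<in> beta_integers \<beta>" "0 \<le> x" "x < \<beta> ^ m" by auto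
  then obtain n where n: "x \<in> greedy_below \<beta> n"
    using beta_integer_imp_greedy_below[OF assms] by blast
  then have "x < \<beta> ^ n" using greedy_below_bounds[OF assms] by blast
  with n have "x \<in> greedy_below \<beta> (m + n)"
    using greedy_below_add_iff[OF assms, of x n m] by (simp add: add.commute)
  then show "x \<in> greedy_below \<beta> m"
    using greedy_below_add_iff[OF assms x(3)] by simp
qed (use greedy_below_bounds[OF assms] greedy_below_imp_beta_integer[OF assms] in auto)

text \<open>
  The \<open>\<beta>\<close>-integers are locally finite. This is what makes the floor of a negative number
  exist: there the floor is minus the least \<open>\<beta>\<close>-integer that is at least \<open>-x\<close>.
\<close>

lemma finite_greedy_below:
  assumes "\<beta> > 1"
  shows "finite (greedy_below \<beta> m)"
proof (induction m)
  case (Suc m)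
  have "greedy_below \<beta> (Suc m) \<subseteq>
      (\<lambda>(d, y). real d * \<beta> ^ m + y) ` ({..nat \<lceil>\<beta>\<rceil>} \<times> greedy_below \<beta> m)"
  proof
    fix x assume "x \<in> greedy_below \<beta> (Suc m)"
    then obtain d :: nat and y where d: "real d < \<beta>" "x = real d * \<beta> ^ m + y"
      and y: "y \<in> greedy_below \<beta> m"
      by (elim greedy_below_SucE)
    have "d \<le> nat \<lceil>\<beta>\<rceil>" using d(1) real_nat_ceiling_ge[of \<beta>] by linarith
    then show "x \<in> (\<lambda>(d, y). real d * \<beta> ^ m + y) ` ({..nat \<lceil>\<beta>\<rceil>} \<times> greedy_below \<beta> m)"
      using d y by (intro image_eqI[of _ _ "(d, y)"]) auto
  qed
  then show ?case using Suc by (meson finite_SigmaI finite_imageI finite_subset finite_atMost)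
qed simp

lemma uminus_beta_integers: "- x \<in> beta_integers \<beta> \<longleftrightarrow> x \<in> beta_integers \<beta>"
  by (simp add: beta_integers_def)

section \<open>Floors with respect to \<open>\<beta>\<close>-integers\<close>

text \<open>
  The relational form of \<open>floor_in\<close>, which also records that the maximum exists.
\<close>

definition is_floor :: "real set \<Rightarrow> real \<Rightarrow> real \<Rightarrow> bool" where
  "is_floor S x e \<longleftrightarrow> e \<in> S \<and> e \<le> x \<and> (\<forall>y\<in>S. y \<le> x \<longrightarrow> y \<le> e)"

lemma floor_in_eq: "is_floor S x e \<Longrightarrow> floor_in S x = e"
  unfolding floor_in_def is_floor_def by (rule Greatest_equality) auto

lemma is_floor_less: "is_floor S x e \<Longrightarrow> x \<notin> S \<Longrightarrow> e < x"
  by (auto simp: is_floor_def less_le)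

lemma is_floor_lt_1:
  assumes "\<beta> > 1" "0 \<le> x" "x < 1"
  shows "is_floor (beta_integers \<beta>) x 0"
proof -
  have "y \<le> 0" if "y \<in> beta_integers \<beta>" "y \<le> x" for y
  proof (rule ccontr)
    assume "\<not> y \<le> 0"
    then have "y \<in> greedy_below \<beta> 0"
      using that assms by (subst greedy_below_eq) auto
    then show False using \<open>\<not> y \<le> 0\<close> by simp
  qed
  moreover have "0 \<in> beta_integers \<beta>"
    using greedy_below_imp_beta_integer[OF assms(1), of 0 0] by simp
  ultimately show ?thesis using assms by (auto simp: is_floor_def)
qed

text \<open>
  Stripping the leading digit reduces a floor to the floor of the remainder: a
  \<open>\<beta>\<close>-integer with a smaller leading digit is less than \<open>d * \<beta> ^ m\<close>, since its lower part
  is below \<open>\<beta> ^ m\<close>, and one with a larger leading digit exceeds \<open>d * \<beta> ^ m + y\<close>. Repeated use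
  computes the floor of any concrete number.
\<close>

lemma is_floor_add_digit:
  assumes "\<beta> > 1" "is_floor (beta_integers \<beta>) y e" "0 \<le> y" "y < \<beta> ^ m"
    and "real d < \<beta>" "real d * \<beta> ^ m + y < \<beta> ^ Suc m"
  shows "is_floor (beta_integers \<beta>) (real d * \<beta> ^ m + y) (real d * \<beta> ^ m + e)"
proof -
  have zero: "0 \<in> beta_integers \<beta>"
    using greedy_below_imp_beta_integer[OF assms(1), of 0 0] by simp
  have e: "0 \<le> e" "e \<le> y" "e \<in> beta_integers \<beta>" 
    using assms(2,3) zero by (auto simp: is_floor_def)
  then have "e \<in> greedy_below \<beta> m" using greedy_below_eq[OF assms(1)] assms(4) by auto
  then have "real d * \<beta> ^ m + e \<in> greedy_below \<beta> (Suc m)"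
    using assms(5,6) e by (intro greedy_below_SucI) auto
  then have mem: "real d * \<beta> ^ m + e \<in> beta_integers \<beta>"
    using greedy_below_imp_beta_integer[OF assms(1)] by blast
  have pos: "\<beta> ^ m > 0" using assms(1) by simp
  have "s \<le> real d * \<beta> ^ m + e"
    if s: "s \<in> beta_integers \<beta>" "s \<le> real d * \<beta> ^ m + y" for s
  proof (cases "s \<ge> 0")
    case True
    then have "s \<in> greedy_below \<beta> (Suc m)"
      using s assms(6) greedy_below_eq[OF assms(1), of "Suc m"] by auto
    then obtain c :: nat and z where c: "s = real c * \<beta> ^ m + z" "z \<in> greedy_below \<beta> m"
      by (elim greedy_below_SucE)
    have z: "0 \<le> z" "z < \<beta> ^ m" "z \<in> beta_integers \<beta>"
      using c(2) greedy_below_eq[OF assms(1)] by auto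
    consider "c < d" | "c = d" | "c > d" by linarith
    then show ?thesis
    proof cases
      case 1
      then have "(real c + 1) * \<beta> ^ m \<le> real d * \<beta> ^ m" using pos by (intro mult_right_mono) auto
      then show ?thesis using c z e by (simp add: algebra_simps)
    next
      case 2
      then show ?thesis using c z s assms(2) by (auto simp: is_floor_def)
    next
      case 3
      then have "(real d + 1) * \<beta> ^ m \<le> real c * \<beta> ^ m" using pos by (intro mult_right_mono) auto
      then show ?thesis using c z s assms(4) by (simp add: algebra_simps)
    qed
  next
    case False
    moreover have "0 \<le> real d * \<beta> ^ m + e" using e pos by simp
    ultimately show ?thesis by linarith
  qed
  then show ?thesis using mem e by (auto simp: is_floor_def)
qed

text \<open>
  The greedy algorithm, stopped before the fractional digits, produces the floor, and what it
  leaves is the tail below \<open>\<beta> ^ 0 = 1\<close>. So complete quotients after a nonnegative one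
  exceed \<open>1\<close>.
\<close>

lemma beta_floor_nonneg_exists:
  assumes "\<beta> > 1" "0 \<le> x"
  shows "\<exists>e. is_floor (beta_integers \<beta>) x e \<and> 0 \<le> e \<and> x < e + 1"
proof -
  have "\<exists>e. is_floor (beta_integers \<beta>) x e \<and> 0 \<le> e \<and> x < e + 1" if "x < \<beta> ^ m" for m
    using that assms(2)
  proof (induction m arbitrary: x)
    case 0
    then show ?case using is_floor_lt_1[OF assms(1), of x] by (intro exI[of _ 0]) auto
  next
    case (Suc m)
    have pos: "\<beta> ^ m > 0" using assms(1) by simp
    define d where "d = nat \<lfloor>x / \<beta> ^ m\<rfloor>"
    have "0 \<le> x / \<beta> ^ m" using Suc.prems pos by simp
    then have d: "real d \<le> x / \<beta> ^ m" "x / \<beta> ^ m < real d + 1"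
      by (simp_all add: d_def)
    have "x / \<beta> ^ m < \<beta>" using Suc.prems pos by (simp add: field_simps)
    then have "real d < \<beta>" using d by linarith
    define y where "y = x - real d * \<beta> ^ m"
    have y: "0 \<le> y" "y < \<beta> ^ m" "x = real d * \<beta> ^ m + y"
      using d pos by (simp_all add: y_def field_simps)
    then obtain e where e: "is_floor (beta_integers \<beta>) y e" "0 \<le> e" "y < e + 1"
      using Suc.IH by blast
    show ?case
      using is_floor_add_digit[OF assms(1) e(1) y(1,2) \<open>real d < \<beta>\<close>] Suc.prems e y pos
      by (intro exI[of _ "real d * \<beta> ^ m + e"]) auto
  qed
  then show ?thesis using real_arch_pow[OF assms(1)] by blast
qed

lemma beta_floor_exists:
  assumes "\<beta> > 1"
  shows "\<exists>e. is_floor (beta_integers \<beta>) x e"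
proof (cases "x \<ge> 0")
  case True
  then show ?thesis using beta_floor_nonneg_exists[OF assms] by blast
next
  case False
  obtain m where m: "- x < \<beta> ^ m" using real_arch_pow[OF assms] by blast
  have lt: "\<beta> ^ m < \<beta> ^ Suc m" using assms by (intro power_strict_increasing) auto
  define A where "A = {s \<in> greedy_below \<beta> (Suc m). - x \<le> s}"
  have "0 \<in> greedy_below \<beta> m"
    using assms greedy_below_imp_beta_integer[OF assms, of 0 0] by (simp add: greedy_below_eq)
  then have "\<beta> ^ m \<in> greedy_below \<beta> (Suc m)"
    using lt assms greedy_below_SucI[of 0 \<beta> m 1] by simp
  then have "\<beta> ^ m \<in> A" using m by (simp add: A_def)
  moreover have "finite A" using finite_greedy_below[OF assms] by (simp add: A_def)
  ultimately have Min: "Min A \<in> A" "\<And>s. s \<in> A \<Longrightarrow> Min A \<le> s" "Min A \<le> \<beta> ^ m" by (auto intro: Min_in)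
  have "y \<le> - Min A" if y: "y \<in> beta_integers \<beta>" "y \<le> x" for y
  proof (cases "- y < \<beta> ^ Suc m")
    case True
    then have "- y \<in> A"
      using y False by (simp add: A_def greedy_below_eq[OF assms] uminus_beta_integers)
    then show ?thesis using Min by fastforce
  next
    case False
    then show ?thesis using Min(3) lt by linarith
  qed
  moreover have "- Min A \<in> beta_integers \<beta>" "- Min A \<le> x"
    using Min(1) by (auto simp: A_def greedy_below_eq[OF assms] uminus_beta_integers)
  ultimately show ?thesis by (auto simp: is_floor_def)
qed

section \<open>The field generated by a square root\<close>

lemma real_subfield_rat_adjoin: "real_subfield (rat_adjoin \<beta>)"
  unfolding rat_adjoin_def real_subfield_def by auto

lemma rat_adjoin_generator: "\<beta> \<in> rat_adjoin \<beta>"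
  by (simp add: rat_adjoin_def)

lemma real_subfield_Rats:
  assumes "real_subfield K" "x \<in> \<rat>"
  shows "x \<in> K"
proof -
  have K: "0 \<in> K" "1 \<in> K" "\<And>x y. x \<in> K \<Longrightarrow> y \<in> K \<Longrightarrow> x + y \<in> K \<and> x * y \<in> K"
      "\<And>x. x \<in> K \<Longrightarrow> - x \<in> K \<and> inverse x \<in> K"
    using assms(1) by (auto simp: real_subfield_def)
  have nat: "real n \<in> K" for n by (induction n) (use K in auto)
  have int: "real_of_int k \<in> K" for k
    using nat[of "nat k"] K(4)[OF nat[of "nat (- k)"]] by (cases "k \<ge> 0") auto
  obtain p q where "x = of_int p / of_int q" using assms(2) by (auto elim!: Rats_cases')
  then show ?thesis using int[of p] int[of q] K(3,4) by (simp add: divide_inverse)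
qed

lemma Rats_independent_1_irrational:
  fixes s a b :: real
  assumes "s \<notin> \<rat>" "a \<in> \<rat>" "b \<in> \<rat>" "a + b * s = 0"
  shows "a = 0" "b = 0"
proof -
  show "b = 0"
  proof (rule ccontr)
    assume "b \<noteq> 0"
    moreover have "b * s = - a" using assms(4) by linarith
    ultimately have "s = - a / b" by (simp add: field_simps)
    then show False using assms(1-3) by auto
  qed
  then show "a = 0" using assms(4) by simp
qed

lemma rat_adjoin_sqrt:
  assumes "sqrt (real D) \<notin> \<rat>"
  shows "rat_adjoin (sqrt (real D)) = {a + b * sqrt (real D) |a b. a \<in> \<rat> \<and> b \<in> \<rat>}"
    (is "?L = ?R")
proof
  have "?R \<subseteq> K" if "real_subfield K" "sqrt (real D) \<in> K" for K
    using that real_subfield_Rats[OF that(1)] by (auto simp: real_subfield_def)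
  then show "?R \<subseteq> ?L"
    using real_subfield_rat_adjoin rat_adjoin_generator by blast
next
  define s where "s = sqrt (real D)"
  have s2: "s * s = real D" by (simp add: s_def)
  have R: "x \<in> ?R" if "x = a + b * s" "a \<in> \<rat>" "b \<in> \<rat>" for x a b
    using that unfolding s_def by blast
  have "real_subfield ?R"
    unfolding real_subfield_def
  proof (intro conjI ballI)
    show "0 \<in> ?R" by (rule R[of _ 0 0]) auto
    show "1 \<in> ?R" by (rule R[of _ 1 0]) auto
  next
    fix x y assume "x \<in> ?R" "y \<in> ?R"
    then obtain a b c d where ab: "x = a + b * s" "a \<in> \<rat>" "b \<in> \<rat>"
      and cd: "y = c + d * s" "c \<in> \<rat>" "d \<in> \<rat>" unfolding s_def by blast
    show "x + y \<in> ?R"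
      by (rule R[of _ "a + c" "b + d"]) (use ab cd in \<open>auto simp: algebra_simps\<close>)
    have "x * y = a * c + b * d * (s * s) + (a * d + b * c) * s"
      using ab cd by (simp add: algebra_simps)
    then show "x * y \<in> ?R"
      by (intro R[of _ "a * c + b * d * real D" "a * d + b * c"]) (use ab cd s2 in auto)
  next
    fix x assume "x \<in> ?R"
    then obtain a b where ab: "x = a + b * s" "a \<in> \<rat>" "b \<in> \<rat>"
      unfolding s_def by blast
    show "- x \<in> ?R"
      by (rule R[of _ "- a" "- b"]) (use ab in auto)
    show "inverse x \<in> ?R"
    proof (cases "x = 0")
      case True
      then show ?thesis by (intro R[of _ 0 0]) auto
    next
      case False
      define N where "N = a * a - b * b * real D"
      have N: "(a + b * s) * (a + (- b) * s) = N"
        using s2 by (simp add: N_def algebra_simps)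
      have "a + (- b) * s \<noteq> 0"
        using Rats_independent_1_irrational[of s a "- b"] ab assms False by (auto simp: s_def)
      then have "N \<noteq> 0" using N False ab by auto
      then have "inverse x = a / N + (- b / N) * s"
        using N False ab(1) by (simp add: field_simps)
      moreover have "N \<in> \<rat>" using ab by (auto simp: N_def)
      ultimately show ?thesis using ab by (intro R[of _ "a / N" "- b / N"]) auto
    qed
  qed
  moreover have "s \<in> ?R" by (rule R[of _ 0 1]) auto
  ultimately show "?L \<subseteq> ?R" unfolding rat_adjoin_def s_def[symmetric] by blast
qed

lemma real_quadratic_field_sqrt:
  assumes "sqrt (real D) \<notin> \<rat>"
  shows "real_quadratic_field (rat_adjoin (sqrt (real D)))"
proof -
  interpret Q: vector_space rat_scale by (rule vector_space_rat_scale)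
  let ?s = "sqrt (real D)"
  have s0: "?s \<noteq> 0" "?s \<noteq> 1" using assms Rats_0 Rats_1 by metis+
  have "1 \<notin> Q.span {?s}"
  proof
    assume "1 \<in> Q.span {?s}"
    then obtain q where "1 = of_rat q * ?s" by (auto simp: Q.span_singleton)
    then show False
      using Rats_independent_1_irrational[of ?s "-1" "of_rat q"] assms by auto
  qed
  then have indep: "Q.independent {1, ?s}"
    using s0 by (simp add: Q.independent_insert)
  have "{1, ?s} \<subseteq> rat_adjoin ?s"
    using real_subfield_rat_adjoin[of ?s] rat_adjoin_generator by (auto simp: real_subfield_def)
  moreover have "rat_adjoin ?s \<subseteq> Q.span {1, ?s}"
  proof
    fix x assume "x \<in> rat_adjoin ?s"
    then obtain a b where "x = of_rat a * 1 + of_rat b * ?s"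
      unfolding rat_adjoin_sqrt[OF assms] by (auto elim!: Rats_cases)
    then show "x \<in> Q.span {1, ?s}"
      by (simp only:) (intro Q.span_add Q.span_scale Q.span_base; simp)
  qed
  moreover have "card {1, ?s} = 2" using s0 by simp
  ultimately have "Q.dim (rat_adjoin ?s) = 2"
    using Q.dim_unique[OF _ _ indep] by blast
  then show ?thesis by (simp add: real_quadratic_field_def real_subfield_rat_adjoin)
qed

text \<open>
  Even powers of \<open>sqrt D\<close> are natural numbers and odd powers are natural multiples of \<open>sqrt D\<close>.
  As the coefficients \<open>u\<close> and \<open>v\<close> are nonnegative, the conjugate \<open>u - v * sqrt D\<close> is at most
  \<open>u + v * sqrt D\<close> in absolute value; periodicity rests on this inequality.
\<close>

lemma greedy_below_sqrt:
  assumes "x \<in> greedy_below (sqrt (real D)) m"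
  shows "\<exists>u v::nat. x = real u + real v * sqrt (real D)"
  using assms
proof (induction m arbitrary: x)
  case 0
  then show ?case by (intro exI[of _ 0]) simp
next
  case (Suc m)
  obtain d y where d: "x = real d * sqrt (real D) ^ m + y" "y \<in> greedy_below (sqrt (real D)) m"
    using Suc.prems by (elim greedy_below_SucE)
  obtain u v :: nat where y: "y = real u + real v * sqrt (real D)" using Suc.IH d(2) by blast
  show ?case
  proof (cases "even m")
    case True
    then obtain k where "m = 2 * k" by blast
    then have "sqrt (real D) ^ m = real (D ^ k)" by (simp add: power_mult)
    then show ?thesis using d(1) y
      by (intro exI[of _ "d * D ^ k + u"] exI[of _ v]) simp
  next
    case False
    then obtain k where "m = 2 * k + 1" by (elim oddE)
    then have "sqrt (real D) ^ m = real (D ^ k) * sqrt (real D)" by (simp add: power_mult)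
    then show ?thesis using d(1) y
      by (intro exI[of _ u] exI[of _ "d * D ^ k + v"]) (simp add: algebra_simps)
  qed
qed

lemma beta_integers_sqrt:
  assumes "sqrt (real D) > 1" "x \<in> beta_integers (sqrt (real D))" "x \<ge> 0"
  shows "\<exists>u v::nat. x = real u + real v * sqrt (real D)"
  using beta_integer_imp_greedy_below[OF assms] greedy_below_sqrt by blast

section \<open>Finitely many complete quotients\<close>

text \<open>
  Write the complete quotient as \<open>x = g / g'\<close> with \<open>g = u + v * s\<close> and \<open>g' = u' + v' * s\<close>. One
  step of the algorithm with partial quotient \<open>a\<close> replaces the pair \<open>(g, g')\<close> by \<open>(g', g - a * g')\<close>
  and the pair of weights \<open>(q, q')\<close> by \<open>(q', q + a * q')\<close>, as for the denominators of
  convergents. The number \<open>g * q' + g' * q\<close> does not change, so \<open>g\<close> and \<open>g'\<close> decay at least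
  as fast as the weights grow, while the conjugates of \<open>g\<close> and \<open>g'\<close> grow at most like the weights.
\<close>

definition cf_invariant :: "real \<Rightarrow> real \<Rightarrow> real \<Rightarrow> real \<Rightarrow> bool" where
  "cf_invariant s C M x \<longleftrightarrow> (\<exists>(u::int) (v::int) (u'::int) (v'::int) (q::real) (q'::real).
     of_int u' + of_int v' * s > 0 \<and>
     of_int u + of_int v * s = x * (of_int u' + of_int v' * s) \<and>
     q > 0 \<and> q' > 0 \<and>
     \<bar>of_int u - of_int v * s\<bar> \<le> C * q \<and> \<bar>of_int u' - of_int v' * s\<bar> \<le> C * q' \<and>
     (of_int u + of_int v * s) * q' + (of_int u' + of_int v' * s) * q \<le> M)"

text \<open>
  A common denominator gives \<open>g\<close> and \<open>g'\<close>; with both weights equal to \<open>1\<close> the constant \<open>C\<close> only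
  has to dominate the two conjugates.
\<close>

lemma cf_invariant_init:
  assumes "a \<in> \<rat>" "b \<in> \<rat>"
  shows "\<exists>C M. C > 0 \<and> cf_invariant s C M (a + b * s)"
proof -
  obtain p q where q: "q > 0" "a = of_int p / of_int q" using assms(1) by (auto elim!: Rats_cases')
  obtain k l where l: "l > 0" "b = of_int k / of_int l" using assms(2) by (auto elim!: Rats_cases')
  define u where "u = p * l"
  define v where "v = k * q"
  define w where "w = q * l"
  have w: "real_of_int w > 0" using q l by (simp add: w_def)
  have eq: "of_int u + of_int v * s = (a + b * s) * of_int w"
    using q l by (simp add: u_def v_def w_def field_simps)
  define C where "C = 1 + \<bar>of_int u - of_int v * s\<bar> + \<bar>real_of_int w\<bar>"
  show ?thesis
  proof (intro exI conjI)
    show "C > 0" by (simp add: C_def add_pos_nonneg)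
    show "cf_invariant s C (of_int u + of_int v * s + of_int w) (a + b * s)"
      unfolding cf_invariant_def
      by (rule exI[of _ u], rule exI[of _ v], rule exI[of _ w], rule exI[of _ 0],
          rule exI[of _ 1], rule exI[of _ 1])
         (use w eq in \<open>auto simp: C_def\<close>)
  qed
qed

text \<open>
  The conjugate of the new \<open>g'\<close> is \<open>h - a' * h'\<close>, where \<open>h\<close>, \<open>h'\<close> and
  \<open>a' = m - n * s\<close> are the conjugates of \<open>g\<close>, \<open>g'\<close> and \<open>a\<close>. Because \<open>\<bar>a'\<bar> \<le> a\<close>, it is
  bounded by \<open>C * q + a * (C * q')\<close>, which is \<open>C\<close> times the new weight.
\<close>

lemma cf_invariant_step:
  assumes "s * s = real D" "s > 0" "C > 0"
    and "cf_invariant s C M x" "a = real m + real n * s" "a < x"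
  shows "cf_invariant s C M (1 / (x - a))"
proof -
  obtain u v u' v' :: int and q q' :: real where
    pos: "of_int u' + of_int v' * s > 0" and
    x: "of_int u + of_int v * s = x * (of_int u' + of_int v' * s)" and
    q: "q > 0" "q' > 0" and
    c: "\<bar>of_int u - of_int v * s\<bar> \<le> C * q" "\<bar>of_int u' - of_int v' * s\<bar> \<le> C * q'" and
    M: "(of_int u + of_int v * s) * q' + (of_int u' + of_int v' * s) * q \<le> M"
    using assms(4) unfolding cf_invariant_def by blast
  define g g' where "g = of_int u + of_int v * s" and "g' = of_int u' + of_int v' * s"
  define h h' where "h = of_int u - of_int v * s" and "h' = of_int u' - of_int v' * s"
  note defs = g_def g'_def h_def h'_def
  define u2 where "u2 = u - (int m * u' + int n * v' * int D)"
  define v2 where "v2 = v - (int m * v' + int n * u')"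
  have ss: "s * (s * z) = real D * z" for z using assms(1) by (metis mult.assoc)
  have g2: "of_int u2 + of_int v2 * s = g - a * g'"
    using assms(1) by (simp add: u2_def v2_def defs assms(5) algebra_simps ss)
  have h2: "of_int u2 - of_int v2 * s = h - (real m - real n * s) * h'"
    using assms(1) by (simp add: u2_def v2_def defs assms(5) algebra_simps ss)
  have a0: "a \<ge> 0" using assms(2,5) by simp
  have "\<bar>real m - real n * s\<bar> \<le> a"
    using assms(2,5) by (simp add: abs_le_iff)
  then have "\<bar>(real m - real n * s) * h'\<bar> \<le> a * (C * q')"
    using c(2) a0 unfolding h'_def abs_mult by (intro mult_mono) auto
  then have "\<bar>h - (real m - real n * s) * h'\<bar> \<le> C * q + a * (C * q')"
    using c(1) unfolding h_def by linarith
  then have h2': "\<bar>of_int u2 - of_int v2 * s\<bar> \<le> C * (q + a * q')"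
    unfolding h2 by (simp add: algebra_simps)
  have g2': "g - a * g' = (x - a) * g'" using x by (simp add: defs algebra_simps)
  have pos2: "g - a * g' > 0" unfolding g2' using pos assms(6) by (simp add: defs)
  have x2: "g' = 1 / (x - a) * (g - a * g')" unfolding g2' using assms(6) by simp
  have M2: "g' * (q + a * q') + (g - a * g') * q' \<le> M"
    using M by (simp add: defs algebra_simps)
  have "q + a * q' > 0" using q a0 by (simp add: add_pos_nonneg)
  then show ?thesis
    unfolding cf_invariant_def
    by (intro exI[of _ u'] exI[of _ v'] exI[of _ u2] exI[of _ v2] exI[of _ q']
        exI[of _ "q + a * q'"])
       (use pos2 x2 q c(2) h2' M2 g2 in \<open>simp add: g'_def[symmetric]\<close>)
qed

text \<open>
  Let \<open>h\<close> and \<open>h'\<close> be the conjugates of \<open>g\<close> and \<open>g'\<close>. Then \<open>x = g * h' / (g' * h')\<close>, where the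
  denominator is the norm of \<open>g'\<close>, an integer. The growth of the conjugates cancels the decay of
  \<open>g\<close> and \<open>g'\<close>, so that \<open>g * h'\<close>, its conjugate \<open>h * g'\<close> and the norm are all bounded by \<open>C * M\<close>
  (for the norm, \<open>x > 1\<close> gives \<open>g' \<le> g\<close>). Finitely many elements \<open>P + Q * s\<close> with integers \<open>P\<close>
  and \<open>Q\<close> are bounded together with their conjugate.
\<close>

lemma finite_cf_invariant:
  assumes "s * s = real D" "s \<ge> 1" "s \<notin> \<rat>" "C > 0"
  shows "finite {x. x > 1 \<and> cf_invariant s C M x}"
proof -
  define R where "R = {- \<lceil>C * M\<rceil>..\<lceil>C * M\<rceil>}"
  have R: "k \<in> R" if "\<bar>real_of_int k\<bar> \<le> C * M" for k
  proof -
    have "k \<le> \<lceil>C * M\<rceil>" "- k \<le> \<lceil>C * M\<rceil>"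
      using that le_of_int_ceiling[of "C * M"] by linarith+
    then show ?thesis unfolding R_def by auto
  qed
  have "\<exists>P\<in>R. \<exists>Q\<in>R. \<exists>N\<in>R. x = (of_int P + of_int Q * s) / of_int N"
    if gt1: "x > 1" and inv: "cf_invariant s C M x" for x
  proof -
    obtain u v u' v' :: int and q q' :: real where
      pos: "of_int u' + of_int v' * s > 0" and
      x: "of_int u + of_int v * s = x * (of_int u' + of_int v' * s)" and
      q: "q > 0" "q' > 0" and
      c: "\<bar>of_int u - of_int v * s\<bar> \<le> C * q" "\<bar>of_int u' - of_int v' * s\<bar> \<le> C * q'" and
      M: "(of_int u + of_int v * s) * q' + (of_int u' + of_int v' * s) * q \<le> M"
      using inv unfolding cf_invariant_def by blast
    define g g' where "g = of_int u + of_int v * s" and "g' = of_int u' + of_int v' * s"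
    define h h' where "h = of_int u - of_int v * s" and "h' = of_int u' - of_int v' * s"
    note defs = g_def g'_def h_def h'_def
    have g': "g' > 0" "g = x * g'" "g' \<le> g" "g > 0"
      using pos x gt1 by (auto simp: defs)
    have gq: "g * q' \<le> M" "g' * q \<le> M"
      using M g'(1,4) q mult_pos_pos[of g q'] mult_pos_pos[of g' q]
      unfolding g_def[symmetric] g'_def[symmetric] by linarith+
    have gh: "\<bar>g * h'\<bar> \<le> C * M"
    proof -
      have "\<bar>g * h'\<bar> \<le> g * (C * q')"
        using c(2) g' by (simp add: defs abs_mult)
      also have "\<dots> \<le> C * M" using gq(1) assms(4) by (simp add: mult.left_commute)
      finally show ?thesis .
    qed
    have hg: "\<bar>h * g'\<bar> \<le> C * M"
    proof -
      have "\<bar>h * g'\<bar> \<le> C * q * g'"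
        using c(1) g' by (simp add: defs abs_mult)
      also have "\<dots> \<le> C * M" using gq(2) assms(4) by (simp add: mult.left_commute mult.commute)
      finally show ?thesis .
    qed
    have gh': "\<bar>g' * h'\<bar> \<le> C * M"
    proof -
      have "\<bar>g' * h'\<bar> \<le> \<bar>g * h'\<bar>"
        using g' by (simp add: abs_mult mult_right_mono)
      then show ?thesis using gh by linarith
    qed
    define P where "P = u * u' - v * v' * int D"
    define Q where "Q = v * u' - u * v'"
    define N where "N = u' * u' - v' * v' * int D"
    have ss: "s * (s * z) = real D * z" for z using assms(1) by (metis mult.assoc)
    have PQ: "of_int P + of_int Q * s = g * h'" "of_int P - of_int Q * s = h * g'"
      using assms(1) by (simp_all add: P_def Q_def defs algebra_simps ss)
    have N: "of_int N = g' * h'"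
      using assms(1) by (simp add: N_def defs algebra_simps ss)
    have "\<bar>real_of_int P\<bar> \<le> C * M" "\<bar>of_int Q * s\<bar> \<le> C * M"
      using gh hg PQ by linarith+
    moreover have "\<bar>real_of_int Q\<bar> \<le> \<bar>of_int Q * s\<bar>"
      using assms(2) by (simp add: abs_mult mult_le_cancel_left1)
    ultimately have "P \<in> R" "Q \<in> R" "N \<in> R"
      using gh' N by (auto intro!: R)
    moreover have "h' \<noteq> 0"
    proof
      assume "h' = 0"
      then have "of_int u' + of_int (- v') * s = 0" by (simp add: defs)
      from Rats_independent_1_irrational[OF assms(3) Rats_of_int Rats_of_int this]
      have "of_int u' = (0::real)" "of_int (- v') = (0::real)" .
      then show False using g'(1) by (simp add: defs)
    qed
    then have "x = (of_int P + of_int Q * s) / of_int N"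
      unfolding PQ N using g' by simp
    ultimately show ?thesis by blast
  qed
  then have "{x. x > 1 \<and> cf_invariant s C M x} \<subseteq>
      (\<lambda>(P, Q, N). (of_int P + of_int Q * s) / of_int N) ` (R \<times> R \<times> R)"
    by force
  then show ?thesis by (rule finite_subset) (simp add: R_def)
qed

section \<open>Eventual periodicity\<close>

text \<open>
  A complete quotient determines all later ones, so the first repetition, which the pigeonhole
  principle provides, starts a period.
\<close>

lemma cf_eventually_periodicI:
  assumes "\<not> cf_finite S \<xi>" "finite F"
    and "\<And>n. n \<ge> k \<Longrightarrow> \<exists>x\<in>F. cf_complete_quotient S \<xi> n = Some x"
  shows "cf_eventually_periodic S \<xi>"
proof -
  let ?c = "cf_complete_quotient S \<xi>"
  have "?c ` {k..} \<subseteq> Some ` F" using assms(3) by force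
  then have "finite (?c ` {k..})" using assms(2) finite_subset by blast
  then have "\<not> inj_on ?c {k..}"
    using finite_imageD infinite_Ici by blast
  then obtain i j where ij: "i < j" "?c i = ?c j"
    unfolding inj_on_def by (metis linorder_neqE_nat)
  have "?c (i + m) = ?c (j + m)" for m
    by (induction m) (use ij in auto)
  then have "?c (n + (j - i)) = ?c n" if "n \<ge> i" for n
    using ij(1) that by (metis Nat.add_diff_assoc2 add.commute le_add_diff_inverse less_imp_le)
  then show ?thesis
    using assms(1) ij(1) unfolding cf_eventually_periodic_def cf_partial_quotient_def
    by (intro conjI exI[of _ i] exI[of _ "j - i"]) auto
qed

lemma not_cf_finite_complete_quotients:
  assumes "\<not> cf_finite S \<xi>"
  obtains x where "\<And>n. cf_complete_quotient S \<xi> n = Some (x n)" "\<And>n. x n \<notin> S" "x 0 = \<xi>"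
    "\<And>n. x (Suc n) = 1 / (x n - floor_in S (x n))"
proof
  let ?x = "\<lambda>n. the (cf_complete_quotient S \<xi> n)"
  have not_None: "cf_complete_quotient S \<xi> n \<noteq> None" for n
    using assms by (simp add: cf_finite_def cf_partial_quotient_def)
  then show some: "cf_complete_quotient S \<xi> n = Some (?x n)" for n by simp
  show notin: "?x n \<notin> S" for n
    using some[of n] not_None[of "Suc n"] by (auto split: option.splits)
  show "?x 0 = \<xi>" by simp
  show "?x (Suc n) = 1 / (?x n - floor_in S (?x n))" for n
    using some[of n] notin[of n]
    by (cases "cf_complete_quotient S \<xi> n") auto
qed

text \<open>
  The first partial quotient may be negative and the second may be \<open>0\<close>; therefore the invariant
  starts at index \<open>1\<close> and the bound \<open>x > 1\<close> is used from index \<open>2\<close> onwards.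
\<close>

lemma CFP_sqrt:
  fixes D :: nat
  assumes irrat: "sqrt (real D) \<notin> \<rat>"
  shows "CFP (sqrt (real D))"
  unfolding CFP_def
proof (intro ballI)
  define s where "s = sqrt (real D)"
  let ?S = "beta_integers s"
  have "D \<noteq> 0" "D \<noteq> 1" using irrat by (metis Rats_0 of_nat_0 real_sqrt_zero, auto)
  then have s: "s > 1" "s * s = real D" "s \<notin> \<rat>" using irrat by (auto simp: s_def)
  fix \<xi> assume "\<xi> \<in> rat_adjoin (sqrt (real D))"
  then have \<xi>: "\<xi> \<in> rat_adjoin s" by (simp add: s_def)
  have K: "real_subfield (rat_adjoin s)" by (rule real_subfield_rat_adjoin)
  have "cf_eventually_periodic ?S \<xi>" if inf: "\<not> cf_finite ?S \<xi>"
  proof -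
    obtain x where c: "\<And>n. cf_complete_quotient ?S \<xi> n = Some (x n)" and notin: "\<And>n. x n \<notin> ?S"
      and x0: "x 0 = \<xi>" and step: "\<And>n. x (Suc n) = 1 / (x n - floor_in ?S (x n))"
      using not_cf_finite_complete_quotients[OF inf] by blast
    define a where "a = (\<lambda>n. floor_in ?S (x n))"
    have a: "is_floor ?S (x n) (a n)" for n
      using beta_floor_exists[OF s(1)] floor_in_eq unfolding a_def by metis
    have lt: "a n < x n" for n using is_floor_less[OF a notin] .
    have x: "x (Suc n) = 1 / (x n - a n)" for n by (simp add: step a_def)
    have pos: "x (Suc n) > 0" for n using lt[of n] by (simp add: x)
    have a_pos: "0 \<le> a (Suc n)" "x (Suc n) < a (Suc n) + 1" for n
      using beta_floor_nonneg_exists[OF s(1), of "x (Suc n)"] pos[of n] a[of "Suc n"] floor_in_eq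
      by (metis less_imp_le)+
    have gt1: "x (Suc (Suc n)) > 1" for n
      using a_pos[of n] lt[of "Suc n"] by (simp add: x[of "Suc n"])
    have a_quad: "\<exists>u v::nat. a (Suc n) = real u + real v * s" for n
      using beta_integers_sqrt[of D "a (Suc n)"] a[of "Suc n"] a_pos(1)[of n] s(1)
      by (auto simp: is_floor_def s_def)
    have a0: "a 0 \<in> rat_adjoin s"
    proof -
      have "\<bar>a 0\<bar> \<in> ?S" using a[of 0] by (auto simp: is_floor_def abs_if uminus_beta_integers)
      then obtain u v :: nat where "\<bar>a 0\<bar> = real u + real v * s"
        using beta_integers_sqrt[of D "\<bar>a 0\<bar>"] s(1) by (auto simp: s_def)
      then have "\<bar>a 0\<bar> \<in> rat_adjoin s"
        using K rat_adjoin_generator[of s] real_subfield_Rats[OF K Rats_of_nat]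
        unfolding real_subfield_def by metis
      then have "- \<bar>a 0\<bar> \<in> rat_adjoin s" "\<bar>a 0\<bar> \<in> rat_adjoin s"
        using K unfolding real_subfield_def by blast+
      then show ?thesis by (cases "a 0 \<ge> 0") auto
    qed
    have "x (Suc 0) = inverse (\<xi> + - a 0)" using x0 by (simp add: x inverse_eq_divide)
    then have "x (Suc 0) \<in> rat_adjoin s"
      using K \<xi> a0 unfolding real_subfield_def by metis
    then obtain p r where "x (Suc 0) = p + r * s" "p \<in> \<rat>" "r \<in> \<rat>"
      using irrat unfolding s_def by (auto simp: rat_adjoin_sqrt)
    then obtain C M where CM: "C > 0" "cf_invariant s C M (x (Suc 0))"
      using cf_invariant_init by metis
    have inv: "cf_invariant s C M (x (Suc n))" for n
    proof (induction n)
      case (Suc n)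
      obtain u v :: nat where "a (Suc n) = real u + real v * s" using a_quad by blast
      then show ?case
        using cf_invariant_step[OF s(2) _ CM(1) Suc _ lt] s(1) by (simp add: x[of "Suc n"])
    qed (use CM in simp)
    have fin: "finite {x. x > 1 \<and> cf_invariant s C M x}"
      using finite_cf_invariant[OF s(2) _ s(3) CM(1)] s(1) by simp
    show ?thesis
    proof (rule cf_eventually_periodicI[OF inf fin])
      fix n :: nat assume "n \<ge> 2"
      then obtain m where "n = Suc (Suc m)" by (metis add_2_eq_Suc le_Suc_ex)
      then show "\<exists>y\<in>{x. x > 1 \<and> cf_invariant s C M x}. cf_complete_quotient ?S \<xi> n = Some y"
        using c[of n] gt1[of m] inv[of "Suc m"] by simp
    qed
  qed
  then show "cf_finite (beta_integers (sqrt (real D))) \<xi> \<or>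
      cf_eventually_periodic (beta_integers (sqrt (real D))) \<xi>"
    unfolding s_def by blast
qed

section \<open>Infinite expansions\<close>

text \<open>
  The algorithm never leaves \<open>T\<close>, and it does not stop there either: an element of \<open>S\<close> is its own
  floor, so \<open>e < x\<close> keeps \<open>x\<close> out of \<open>S\<close>.
\<close>

lemma not_cf_finiteI:
  assumes "\<xi> \<in> T"
    and "\<And>x. x \<in> T \<Longrightarrow> \<exists>e. is_floor S x e \<and> e < x \<and> 1 / (x - e) \<in> T"
  shows "\<not> cf_finite S \<xi>"
proof -
  have "\<exists>x\<in>T. cf_complete_quotient S \<xi> n = Some x" for n
  proof (induction n)
    case (Suc n)
    then obtain x where x: "x \<in> T" "cf_complete_quotient S \<xi> n = Some x" by blast
    then obtain e where e: "is_floor S x e" "e < x" "1 / (x - e) \<in> T" using assms(2) by blast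
    then have "x \<notin> S" by (auto simp: is_floor_def)
    then show ?case using x e floor_in_eq[OF e(1)] by simp
  qed (use assms(1) in simp)
  then have "cf_complete_quotient S \<xi> n \<noteq> None" for n
    by (metis option.distinct(1))
  then show ?thesis
    by (simp add: cf_finite_def cf_partial_quotient_def)
qed

lemma is_floor_digit_lt_beta:
  assumes "\<beta> > 1" "real d < \<beta>" "real d \<le> x" "x < real d + 1" "x < \<beta>"
  shows "is_floor (beta_integers \<beta>) x (real d)"
  using is_floor_add_digit[OF assms(1) is_floor_lt_1[OF assms(1), of "x - real d"], of 0 d] assms
  by simp

lemma is_floor_digit_power:
  assumes "\<beta> > 1" "real d < \<beta>" "real d * \<beta> ^ m \<le> x" "x < real d * \<beta> ^ m + 1" "x < \<beta> ^ Suc m"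
  shows "is_floor (beta_integers \<beta>) x (real d * \<beta> ^ m)"
proof -
  have "x - real d * \<beta> ^ m < \<beta> ^ m"
    using assms(1,4) one_le_power[of \<beta> m] by linarith
  then show ?thesis
    using is_floor_add_digit[OF assms(1) is_floor_lt_1[OF assms(1), of "x - real d * \<beta> ^ m"], of m d] assms
    by simp
qed

lemma CFF_imp_cf_finite_sqrt:
  assumes "CFF (sqrt (real D))" "a \<in> \<rat>" "b \<in> \<rat>"
  shows "cf_finite (beta_integers (sqrt (real D))) (a + b * sqrt (real D))"
proof -
  have "a + b * sqrt (real D) \<in> rat_adjoin (sqrt (real D))"
    using real_subfield_rat_adjoin[of "sqrt (real D)"] rat_adjoin_generator
      real_subfield_Rats[OF real_subfield_rat_adjoin] assms(2,3)
    unfolding real_subfield_def by blast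
  then show ?thesis using assms(1) by (simp add: CFF_def)
qed

text \<open>
  For small \<open>D\<close> the field contains an explicit number whose expansion is purely periodic of
  period one or two. The positive root \<open>x\<close> of \<open>b * x^2 = a * b * x + a\<close> has the regular expansion
  \<open>[a, b, a, b, \<dots>]\<close> and lies in the field when \<open>t^2 + 4 * t\<close>, for \<open>t = a * b\<close>, is \<open>D\<close> times a
  square. The pairs \<open>(a, b)\<close> used for \<open>D = 2, 3, 5, 6, 7, 8\<close> are \<open>(2, 2)\<close>, \<open>(4, 3)\<close>, \<open>(1, 1)\<close>,
  \<open>(8, 12)\<close>, \<open>(7, 2)\<close> and \<open>(2, 2)\<close>. They are chosen such that \<open>a\<close> and \<open>b\<close> are \<open>\<beta>\<close>-integers
  and remain the floors of the complete quotients when only \<open>\<beta>\<close>-integers are admitted.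
\<close>

lemma not_CFF_sqrt2: "\<not> CFF (sqrt 2)"
proof
  define s where "s = sqrt (2::real)"
  have ss: "s * s = 2" and s: "1.4 < s" "s < 1.5"
    unfolding s_def by (simp, rule real_less_rsqrt, simp add: power2_eq_square,
        rule real_less_lsqrt, simp_all add: power2_eq_square)
  assume "CFF (sqrt 2)"
  from CFF_imp_cf_finite_sqrt[of 2 1 1] this have "cf_finite (beta_integers s) (1 + s)"
    by (simp add: s_def)
  moreover have "\<not> cf_finite (beta_integers s) (1 + s)"
  proof (rule not_cf_finiteI[where T = "{1 + s}"])
    have "is_floor (beta_integers s) (1 + s) (real 1 * s ^ 2)"
      by (rule is_floor_digit_power) (use ss s in \<open>auto simp: power2_eq_square power3_eq_cube\<close>)
    moreover have "1 / (1 + s - 2) = 1 + s" using ss s by (simp add: field_simps)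
    ultimately show "\<exists>e. is_floor (beta_integers s) x e \<and> e < x \<and> 1 / (x - e) \<in> {1 + s}"
      if "x \<in> {1 + s}" for x
      using that ss s by (intro exI[of _ 2]) (simp add: power2_eq_square)
  qed simp
  ultimately show False by blast
qed

lemma not_CFF_sqrt3: "\<not> CFF (sqrt 3)"
proof
  define s where "s = sqrt (3::real)"
  have ss: "s * s = 3" and s: "1.73 < s" "s < 1.74"
    unfolding s_def by (simp, rule real_less_rsqrt, simp add: power2_eq_square,
        rule real_less_lsqrt, simp_all add: power2_eq_square)
  have s1: "s > 1" using s by simp
  let ?x = "2 + 4/3 * s" and ?y = "3/2 + s"
  assume "CFF (sqrt 3)"
  from CFF_imp_cf_finite_sqrt[of 3 2 "4/3"] this have "cf_finite (beta_integers s) ?x"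
    by (simp add: s_def)
  moreover have "\<not> cf_finite (beta_integers s) ?x"
  proof (rule not_cf_finiteI[where T = "{?x, ?y}"])
    \<comment> \<open>The floor of \<open>2 + 4/3 * s\<close> has the two digits \<open>4 = 1 * s^2 + 1\<close>.\<close>
    have "is_floor (beta_integers s) (4/3 * s - 1) (real 1)"
      by (rule is_floor_digit_lt_beta) (use s in auto)
    from is_floor_add_digit[OF s1 this, of 2 1]
    have "is_floor (beta_integers s) ?x 4"
      using ss s by (simp add: power2_eq_square power3_eq_cube)
    moreover have "1 / (?x - 4) = ?y" using ss s by (simp add: field_simps)
    moreover have "is_floor (beta_integers s) ?y (real 1 * s ^ 2)"
      by (rule is_floor_digit_power) (use ss s in \<open>auto simp: power2_eq_square power3_eq_cube\<close>)
    moreover have "1 / (?y - 3) = ?x" using ss s by (simp add: field_simps)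
    ultimately show "\<exists>e. is_floor (beta_integers s) x e \<and> e < x \<and> 1 / (x - e) \<in> {?x, ?y}"
      if "x \<in> {?x, ?y}" for x
      using that ss s
      by (elim insertE; intro exI[of _ "if x = ?x then 4 else 3"]) (auto simp: power2_eq_square)
  qed simp
  ultimately show False by blast
qed

lemma not_CFF_sqrt5: "\<not> CFF (sqrt 5)"
proof
  define s where "s = sqrt (5::real)"
  have ss: "s * s = 5" and s: "2.2 < s" "s < 2.3"
    unfolding s_def by (simp, rule real_less_rsqrt, simp add: power2_eq_square,
        rule real_less_lsqrt, simp_all add: power2_eq_square)
  let ?x = "1/2 + 1/2 * s"
  assume "CFF (sqrt 5)"
  from CFF_imp_cf_finite_sqrt[of 5 "1/2" "1/2"] this have "cf_finite (beta_integers s) ?x"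
    by (simp add: s_def)
  moreover have "\<not> cf_finite (beta_integers s) ?x"
  proof (rule not_cf_finiteI[where T = "{?x}"])
    have "is_floor (beta_integers s) ?x (real 1)"
      by (rule is_floor_digit_lt_beta) (use s in auto)
    moreover have "1 / (?x - 1) = ?x" using ss s by (simp add: field_simps)
    ultimately show "\<exists>e. is_floor (beta_integers s) x e \<and> e < x \<and> 1 / (x - e) \<in> {?x}"
      if "x \<in> {?x}" for x
      using that s by (intro exI[of _ 1]) simp
  qed simp
  ultimately show False by blast
qed

lemma not_CFF_sqrt6: "\<not> CFF (sqrt 6)"
proof
  define s where "s = sqrt (6::real)"
  have ss: "s * s = 6" and s: "2.44 < s" "s < 2.45"
    unfolding s_def by (simp, rule real_less_rsqrt, simp add: power2_eq_square,
        rule real_less_lsqrt, simp_all add: power2_eq_square)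
  have s1: "s > 1" using s by simp
  let ?x = "4 + 5/3 * s" and ?y = "6 + 5/2 * s"
  assume "CFF (sqrt 6)"
  from CFF_imp_cf_finite_sqrt[of 6 4 "5/3"] this have "cf_finite (beta_integers s) ?x"
    by (simp add: s_def)
  moreover have "\<not> cf_finite (beta_integers s) ?x"
  proof (rule not_cf_finiteI[where T = "{?x, ?y}"])
    \<comment> \<open>The floor of \<open>4 + 5/3 * s\<close> has the two digits \<open>8 = 1 * s^2 + 2\<close>.\<close>
    have "is_floor (beta_integers s) (5/3 * s - 2) (real 2)"
      by (rule is_floor_digit_lt_beta) (use s in auto)
    from is_floor_add_digit[OF s1 this, of 2 1]
    have "is_floor (beta_integers s) ?x 8"
      using ss s by (simp add: power2_eq_square power3_eq_cube)
    moreover have "1 / (?x - 8) = ?y" using ss s by (simp add: field_simps)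
    moreover have "is_floor (beta_integers s) ?y (real 2 * s ^ 2)"
      by (rule is_floor_digit_power) (use ss s in \<open>auto simp: power2_eq_square power3_eq_cube\<close>)
    moreover have "1 / (?y - 12) = ?x" using ss s by (simp add: field_simps)
    ultimately show "\<exists>e. is_floor (beta_integers s) x e \<and> e < x \<and> 1 / (x - e) \<in> {?x, ?y}"
      if "x \<in> {?x, ?y}" for x
      using that ss s
      by (elim insertE; intro exI[of _ "if x = ?x then 8 else 12"]) (auto simp: power2_eq_square)
  qed simp
  ultimately show False by blast
qed

lemma not_CFF_sqrt7: "\<not> CFF (sqrt 7)"
proof
  define s where "s = sqrt (7::real)"
  have ss: "s * s = 7" and s: "2.64 < s" "s < 2.65"
    unfolding s_def by (simp, rule real_less_rsqrt, simp add: power2_eq_square,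
        rule real_less_lsqrt, simp_all add: power2_eq_square)
  let ?x = "7/2 + 3/2 * s" and ?y = "1 + 3/7 * s"
  assume "CFF (sqrt 7)"
  from CFF_imp_cf_finite_sqrt[of 7 "7/2" "3/2"] this have "cf_finite (beta_integers s) ?x"
    by (simp add: s_def)
  moreover have "\<not> cf_finite (beta_integers s) ?x"
  proof (rule not_cf_finiteI[where T = "{?x, ?y}"])
    have "is_floor (beta_integers s) ?x (real 1 * s ^ 2)"
      by (rule is_floor_digit_power) (use ss s in \<open>auto simp: power2_eq_square power3_eq_cube\<close>)
    moreover have "1 / (?x - 7) = ?y" using ss s by (simp add: field_simps)
    moreover have "is_floor (beta_integers s) ?y (real 2)"
      by (rule is_floor_digit_lt_beta) (use s in auto)
    moreover have "1 / (?y - 2) = ?x" using ss s by (simp add: field_simps)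
    ultimately show "\<exists>e. is_floor (beta_integers s) x e \<and> e < x \<and> 1 / (x - e) \<in> {?x, ?y}"
      if "x \<in> {?x, ?y}" for x
      using that ss s
      by (elim insertE; intro exI[of _ "if x = ?x then 7 else 2"]) (auto simp: power2_eq_square)
  qed simp
  ultimately show False by blast
qed

lemma not_CFF_sqrt8: "\<not> CFF (sqrt 8)"
proof
  define s where "s = sqrt (8::real)"
  have ss: "s * s = 8" and s: "2.8 < s" "s < 2.9"
    unfolding s_def by (simp, rule real_less_rsqrt, simp add: power2_eq_square,
        rule real_less_lsqrt, simp_all add: power2_eq_square)
  let ?x = "1 + 1/2 * s"
  assume "CFF (sqrt 8)"
  from CFF_imp_cf_finite_sqrt[of 8 1 "1/2"] this have "cf_finite (beta_integers s) ?x"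
    by (simp add: s_def)
  moreover have "\<not> cf_finite (beta_integers s) ?x"
  proof (rule not_cf_finiteI[where T = "{?x}"])
    have "is_floor (beta_integers s) ?x (real 2)"
      by (rule is_floor_digit_lt_beta) (use s in auto)
    moreover have "1 / (?x - 2) = ?x" using ss s by (simp add: field_simps)
    ultimately show "\<exists>e. is_floor (beta_integers s) x e \<and> e < x \<and> 1 / (x - e) \<in> {?x}"
      if "x \<in> {?x}" for x
      using that s by (intro exI[of _ 2]) simp
  qed simp
  ultimately show False by blast
qed

text \<open>
  All complete quotients of the regular expansion lie below \<open>3\<close>. The nonnegative
  \<open>\<beta>\<close>-integers below \<open>\<beta>\<close> are the ordinary integers \<open>0, 1, 2, \<dots>\<close>, so for \<open>\<beta> \<ge> 3\<close> both
  algorithms make the same choices.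
\<close>

lemma not_cf_finite_of_partial_quotients_1_2:
  assumes "\<beta> \<ge> 3" "\<And>n. cf_partial_quotient \<int> \<xi> n \<in> {Some 1, Some 2}"
  shows "\<not> cf_finite (beta_integers \<beta>) \<xi>"
proof (rule not_cf_finiteI[where T = "{x. \<exists>n. cf_complete_quotient \<int> \<xi> n = Some x}"])
  show "\<xi> \<in> {x. \<exists>n. cf_complete_quotient \<int> \<xi> n = Some x}"
    by (auto intro: exI[of _ 0])
next
  fix x assume "x \<in> {x. \<exists>n. cf_complete_quotient \<int> \<xi> n = Some x}"
  then obtain n where n: "cf_complete_quotient \<int> \<xi> n = Some x" by blast
  then have "real_of_int \<lfloor>x\<rfloor> \<in> {1, 2}"
    using assms(2)[of n] by (auto simp: cf_partial_quotient_def floor_in_Ints)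
  then have fl: "\<lfloor>x\<rfloor> = 1 \<or> \<lfloor>x\<rfloor> = 2" by auto
  define d where "d = nat \<lfloor>x\<rfloor>"
  have d: "real d = of_int \<lfloor>x\<rfloor>" "real d \<le> 2" using fl by (auto simp: d_def)
  have "x \<notin> \<int>"
    using assms(2)[of "Suc n"] n by (auto simp: cf_partial_quotient_def split: if_splits)
  then have next_quotient: "cf_complete_quotient \<int> \<xi> (Suc n) = Some (1 / (x - real d))"
    using n d by (simp add: floor_in_Ints)
  have "x \<noteq> real d" using \<open>x \<notin> \<int>\<close> by auto
  then have "real d < x" "x < real d + 1" using d(1) by linarith+
  moreover have "is_floor (beta_integers \<beta>) x (real d)"
    by (rule is_floor_digit_lt_beta) (use calculation d assms(1) in linarith)+
  ultimately show "\<exists>e. is_floor (beta_integers \<beta>) x e \<and> e < x \<and>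
      1 / (x - e) \<in> {x. \<exists>n. cf_complete_quotient \<int> \<xi> n = Some x}"
    using next_quotient by blast
qed

lemma not_CFF_sqrt_ge_9:
  assumes "D \<ge> 9" "sqrt (real D) \<notin> \<rat>" "Mercat_conjecture"
  shows "\<not> CFF (sqrt (real D))"
proof -
  have "sqrt (real D) \<ge> 3" using assms(1) by (intro real_le_rsqrt) auto
  moreover obtain \<xi> where "\<xi> \<in> rat_adjoin (sqrt (real D))"
    "\<And>n. cf_partial_quotient \<int> \<xi> n \<in> {Some 1, Some 2}"
    using assms(3) real_quadratic_field_sqrt[OF assms(2)] unfolding Mercat_conjecture_def by blast
  ultimately show ?thesis
    using not_cf_finite_of_partial_quotients_1_2 unfolding CFF_def by blast
qed

theorem theorem6p9:
  fixes D :: nat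
  assumes "D > 0" and "sqrt (real D) \<notin> \<rat>"
  shows "CFP (sqrt (real D)) \<and> (Mercat_conjecture \<longrightarrow> \<not> CFF (sqrt (real D)))"
proof (intro conjI impI)
  show "CFP (sqrt (real D))" using CFP_sqrt[OF assms(2)] .
next
  assume "Mercat_conjecture"
  have "D \<noteq> 1" "D \<noteq> 4" using assms(2) by (auto simp: real_sqrt_four)
  then have "D \<in> {2, 3, 5, 6, 7, 8} \<or> D \<ge> 9" using assms(1) by auto
  then show "\<not> CFF (sqrt (real D))"
    using not_CFF_sqrt2 not_CFF_sqrt3 not_CFF_sqrt5 not_CFF_sqrt6 not_CFF_sqrt7 not_CFF_sqrt8
      not_CFF_sqrt_ge_9[OF _ assms(2) \<open>Mercat_conjecture\<close>]
    by auto
qed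

end
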